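(* Let $\mathsf{H}$ be a quaternionic Hilbert space, let $T\in\mathfrak{B}(\mathsf{H})$ be a normal operator, let $J\in\mathfrak{B}(\mathsf{H})$ be an anti self-adjoint and unitary operator such that $TJ=JT$ and $T^*J=JT^*$, let $\imath\in\mathbb{S}$ and let $\mathsf{H}^{J\imath}_\pm=\{u\in\mathsf{H}:Ju=\pm u\imath\}$. Then: (a) $T(\mathsf{H}_+^{J\imath})\subset\mathsf{H}_+^{J\imath}$ and $T^*(\mathsf{H}_+^{J\imath})\subset\mathsf{H}_+^{J\imath}$. Moreover, if $T|_{\mathsf{H}_+^{J\imath}}$ and $T^*|_{\mathsf{H}_+^{J\imath}}$ denote the $\mathbb{C}_\imath$-complex operators in $\mathfrak{B}(\mathsf{H}_+^{J\imath})$ obtained by restricting $T$ and $T^*$ to $\mathsf{H}_+^{J\imath}$, then: (b) $(T|_{\mathsf{H}_+^{J\imath}})^*=T^*|_{\mathsf{H}_+^{J\imath}}$. (c) $\sigma(T|_{\mathsf{H}_+^{J\imath}})\cup\overline{\sigma(T|_{\mathsf{H}_+^{J\imath}})}=\sigma_S(T)\cap\mathbb{C}_\imath$, where $\sigma(T|_{\mathsf{H}_+^{J\imath}})$ is considered as a subset of $\mathbb{C}_\imath$ via the identification $\mathbb{C}\ni\alpha+i\beta\mapsto\alpha+\imath\beta\in\mathbb{C}_\imath$. (d) $\sigma_S(T)=\Omega_{\mathcal K}$, where $\mathcal K:=\sigma(T|_{\mathsf{H}_+^{J\imath}})$. The same assertions hold with $\mathsf{H}^{J\imath}_-$ in place of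 $\mathsf{H}^{J\imath}_+$.
   Context: $\mathbb{H}$ denotes the quaternions, with conjugation $q\mapsto\overline q$ and norm $|q|=\sqrt{q\overline q}$; $\mathbb{S}=\{q\in\mathbb{H}:q^2=-1\}$; $\mathbb{C}_\imath=\{\alpha+\imath\beta:\alpha,\beta\in\mathbb{R}\}$. A quaternionic Hilbert space $\mathsf{H}$ is a nonzero right $\mathbb{H}$-module with a scalar product $\langle\cdot|\cdot\rangle$ valued in $\mathbb{H}$, right $\mathbb{H}$-linear in the second argument, with $\langle u|v\rangle=\overline{\langle v|u\rangle}$, $\langle u|u\rangle\ge0$ (zero only for $u=0$), complete for $\|u\|=\sqrt{\langle u|u\rangle}$. $\mathfrak{B}(\mathsf{H})$: everywhere defined bounded right $\mathbb{H}$-linear operators. Normal: $TT^*=T^*T$; anti self-adjoint: $J^*=-J$; unitary: $J^*J=JJ^*=\mathrm{I}$. $\mathsf{H}^{J\imath}_\pm$ are nonzero complex Hilbert spaces over $\mathbb{C}_\imath\cong\mathbb{C}$, with scalar multiplication the right multiplication by $\mathbb{C}_\imath$ and scalar product the restriction of $\langle\cdot|\cdot\rangle$. $\sigma(B)$ is the standard spectrum of a bounded operator $B$ on a complex Hilbert space, and a bar over a subset of $\mathbb{C}_\imath$ denotes complex conjugation. $\Delta_q(T):=T^2-T(q+\overline q)+\mathrm{I}|q|^2$, with $(Tr)(u)=T(u)r$ for $r\in\mathbb{R}$; for $T\in\mathfrak{B}(\mathsf{H})$ the spherical spectrum $\sigma_S(T)$ is the set of $q\in\mathbb{H}$ such that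 $\Delta_q(T)$ is not invertible in $\mathfrak{B}(\mathsf{H})$. For $\mathcal K\subset\mathbb{C}$, $\Omega_{\mathcal K}:=\{\alpha+\jmath\beta:\alpha,\beta\in\mathbb{R},\ \alpha+i\beta\in\mathcal K,\ \jmath\in\mathbb{S}\}$. *)

theory Defs
  imports Complex_Main "HOL-Library.FuncSet"
begin

section \<open>Quaternions\<close>

datatype quat = Quat (qRe: real) (qIm1: real) (qIm2: real) (qIm3: real)

lemma quat_eq_iff:
  "p = q \<longleftrightarrow> qRe p = qRe q \<and> qIm1 p = qIm1 q \<and> qIm2 p = qIm2 q \<and> qIm3 p = qIm3 q"
  by (cases p; cases q) simp

instantiation quat :: real_algebra_1
begin

definition "0 = Quat 0 0 0 0"
definition "1 = Quat 1 0 0 0"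
definition "p + q = Quat (qRe p + qRe q) (qIm1 p + qIm1 q) (qIm2 p + qIm2 q) (qIm3 p + qIm3 q)"
definition "p - q = Quat (qRe p - qRe q) (qIm1 p - qIm1 q) (qIm2 p - qIm2 q) (qIm3 p - qIm3 q)"
definition "- q = Quat (- qRe q) (- qIm1 q) (- qIm2 q) (- qIm3 q)"
definition "p * q = Quat
  (qRe p * qRe q - qIm1 p * qIm1 q - qIm2 p * qIm2 q - qIm3 p * qIm3 q)
  (qRe p * qIm1 q + qIm1 p * qRe q + qIm2 p * qIm3 q - qIm3 p * qIm2 q)
  (qRe p * qIm2 q - qIm1 p * qIm3 q + qIm2 p * qRe q + qIm3 p * qIm1 q)
  (qRe p * qIm3 q + qIm1 p * qIm2 q - qIm2 p * qIm1 q + qIm3 p * qRe q)"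
definition "r *\<^sub>R q = Quat (r * qRe q) (r * qIm1 q) (r * qIm2 q) (r * qIm3 q)"

instance
  by standard
    (auto simp: quat_eq_iff zero_quat_def one_quat_def plus_quat_def minus_quat_def
      uminus_quat_def times_quat_def scaleR_quat_def algebra_simps)

end

definition qcnj :: "quat \<Rightarrow> quat" where
  "qcnj q = Quat (qRe q) (- qIm1 q) (- qIm2 q) (- qIm3 q)"

text \<open>The product \<open>q * qcnj q\<close> is real.\<close>
definition qnorm :: "quat \<Rightarrow> real" where
  "qnorm q = sqrt (qRe (q * qcnj q))"

definition imag_units :: "quat set" where
  "imag_units = {q. q\<^sup>2 = -1}"

text \<open>The identification of \<open>\<complex>\<close> with the slice \<open>\<complex>\<^sub>\<iota>\<close>; it is injective for \<open>\<iota> \<in> imag_units\<close>.\<close>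
definition to_slice :: "quat \<Rightarrow> complex \<Rightarrow> quat" where
  "to_slice \<iota> z = of_real (Re z) + \<iota> * of_real (Im z)"

definition slice :: "quat \<Rightarrow> quat set" where
  "slice \<iota> = {of_real \<alpha> + \<iota> * of_real \<beta> | \<alpha> \<beta>. True}"

definition circularization :: "complex set \<Rightarrow> quat set" where
  "circularization K =
     {of_real \<alpha> + j * of_real \<beta> | \<alpha> \<beta> j. Complex \<alpha> \<beta> \<in> K \<and> j \<in> imag_units}"


section \<open>Quaternionic Hilbert spaces and their bounded operators\<close>

text \<open>
  The real vector space structure and the norm of \<^class>\<open>banach\<close> are determined by the right
  \<open>quat\<close>-module structure and the scalar product through the axioms \<open>scaleR_eq_qscale\<close> and
  \<open>norm_eq_qinner\<close>, so \<^class>\<open>banach\<close> contributes exactly completeness. By \<open>qinner_commute\<close>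
  the quaternion \<open>qinner u u\<close> is real, hence \<open>qinner u u \<ge> 0\<close> is a condition on its real part.
\<close>
class quaternionic_hilbert = banach +
  fixes qscale :: "'a \<Rightarrow> quat \<Rightarrow> 'a"  (infixl "\<bullet>q" 75)
    and qinner :: "'a \<Rightarrow> 'a \<Rightarrow> quat"
  assumes qscale_add_left: "(u + v) \<bullet>q p = u \<bullet>q p + v \<bullet>q p"
    and qscale_add_right: "u \<bullet>q (p + q) = u \<bullet>q p + u \<bullet>q q"
    and qscale_mult: "u \<bullet>q (p * q) = u \<bullet>q p \<bullet>q q"
    and qscale_one: "u \<bullet>q 1 = u"
    and scaleR_eq_qscale: "r *\<^sub>R u = u \<bullet>q of_real r"
    and qinner_add_right: "qinner u (v + w) = qinner u v + qinner u w"
    and qinner_qscale_right: "qinner u (v \<bullet>q p) = qinner u v * p"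
    and qinner_commute: "qinner u v = qcnj (qinner v u)"
    and qinner_nonneg: "0 \<le> qRe (qinner u u)"
    and qinner_eq_zero: "qinner u u = 0 \<Longrightarrow> u = 0"
    and norm_eq_qinner: "norm u = sqrt (qRe (qinner u u))"
    and nonzero_space: "\<exists>u. u \<noteq> 0"

definition qoperators :: "('a::quaternionic_hilbert \<Rightarrow> 'a) set" where
  "qoperators = {T. bounded_linear T \<and> (\<forall>u q. T (u \<bullet>q q) = T u \<bullet>q q)}"

text \<open>For \<open>T \<in> qoperators\<close> the Riesz representation theorem shows that the description is satisfied by exactly one operator.\<close>
definition qadjoint :: "('a::quaternionic_hilbert \<Rightarrow> 'a) \<Rightarrow> 'a \<Rightarrow> 'a" where
  "qadjoint T = (THE S. S \<in> qoperators \<and> (\<forall>u v. qinner (S u) v = qinner u (T v)))"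

definition qnormal :: "('a::quaternionic_hilbert \<Rightarrow> 'a) \<Rightarrow> bool" where
  "qnormal T \<longleftrightarrow> T \<circ> qadjoint T = qadjoint T \<circ> T"

definition anti_self_adjoint :: "('a::quaternionic_hilbert \<Rightarrow> 'a) \<Rightarrow> bool" where
  "anti_self_adjoint J \<longleftrightarrow> qadjoint J = (\<lambda>u. - J u)"

definition qunitary :: "('a::quaternionic_hilbert \<Rightarrow> 'a) \<Rightarrow> bool" where
  "qunitary J \<longleftrightarrow> qadjoint J \<circ> J = id \<and> J \<circ> qadjoint J = id"

definition Delta :: "quat \<Rightarrow> ('a::quaternionic_hilbert \<Rightarrow> 'a) \<Rightarrow> 'a \<Rightarrow> 'a" where
  "Delta q T u = T (T u) - T u \<bullet>q (q + qcnj q) + u \<bullet>q of_real ((qnorm q)\<^sup>2)"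

definition spherical_spectrum :: "('a::quaternionic_hilbert \<Rightarrow> 'a) \<Rightarrow> quat set" where
  "spherical_spectrum T =
     {q. \<not> (\<exists>S\<in>qoperators. S \<circ> Delta q T = id \<and> Delta q T \<circ> S = id)}"


section \<open>Operators on complex Hilbert spaces given by a carrier\<close>

text \<open>Addition is inherited from the ambient type.\<close>
record 'v complex_space =
  Carrier :: "'v set"
  cscale :: "complex \<Rightarrow> 'v \<Rightarrow> 'v"
  cinner :: "'v \<Rightarrow> 'v \<Rightarrow> complex"

definition cnorm :: "'v complex_space \<Rightarrow> 'v \<Rightarrow> real" where
  "cnorm E u = sqrt (Re (cinner E u u))"

text \<open>Operators are extensional functions, so equality of operators is equality on the carrier.\<close>
definition coperators :: "('v::ab_group_add) complex_space \<Rightarrow> ('v \<Rightarrow> 'v) set" where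
  "coperators E = {A \<in> Carrier E \<rightarrow>\<^sub>E Carrier E.
     (\<forall>u\<in>Carrier E. \<forall>v\<in>Carrier E. A (u + v) = A u + A v) \<and>
     (\<forall>z. \<forall>u\<in>Carrier E. A (cscale E z u) = cscale E z (A u)) \<and>
     (\<exists>C. \<forall>u\<in>Carrier E. cnorm E (A u) \<le> C * cnorm E u)}"

definition cadjoint :: "('v::ab_group_add) complex_space \<Rightarrow> ('v \<Rightarrow> 'v) \<Rightarrow> 'v \<Rightarrow> 'v" where
  "cadjoint E A = (THE B. B \<in> coperators E \<and>
     (\<forall>u\<in>Carrier E. \<forall>v\<in>Carrier E. cinner E (B u) v = cinner E u (A v)))"

definition cspectrum :: "('v::ab_group_add) complex_space \<Rightarrow> ('v \<Rightarrow> 'v) \<Rightarrow> complex set" where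
  "cspectrum E A = {z. \<not> (\<exists>B\<in>coperators E. \<forall>u\<in>Carrier E.
     B (A u - cscale E z u) = u \<and> A (B u) - cscale E z (B u) = u)}"


section \<open>The complex subspaces of an anti self-adjoint unitary operator\<close>

text \<open>
  For \<open>u\<close> and \<open>v\<close> in the carriers below, \<open>qinner u v\<close> lies in \<open>slice \<iota> = range (to_slice \<iota>)\<close>, so
  \<open>inv (to_slice \<iota>)\<close> only transports the scalar product to \<^typ>\<open>complex\<close>.
\<close>
definition H_plus :: "('a::quaternionic_hilbert \<Rightarrow> 'a) \<Rightarrow> quat \<Rightarrow> 'a complex_space" where
  "H_plus J \<iota> =
     \<lparr>Carrier = {u. J u = u \<bullet>q \<iota>},
      cscale = (\<lambda>z u. u \<bullet>q to_slice \<iota> z),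
      cinner = (\<lambda>u v. inv (to_slice \<iota>) (qinner u v))\<rparr>"

definition H_minus :: "('a::quaternionic_hilbert \<Rightarrow> 'a) \<Rightarrow> quat \<Rightarrow> 'a complex_space" where
  "H_minus J \<iota> =
     \<lparr>Carrier = {u. J u = - (u \<bullet>q \<iota>)},
      cscale = (\<lambda>z u. u \<bullet>q to_slice \<iota> z),
      cinner = (\<lambda>u v. inv (to_slice \<iota>) (qinner u v))\<rparr>"

end

theory Submission
  imports Defs
begin

text \<open>
  Right multiplication by an imaginary unit \<open>j\<close> anticommuting with \<open>\<iota>\<close> gives
  \<open>H = H\<^sub>+ \<oplus> H\<^sub>+ j\<close>. For \<open>q = to_slice \<iota> z\<close> the operator \<open>\<Delta>\<^sub>q(T)\<close> acts on \<open>H\<^sub>+\<close> as the product of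
  the commuting factors \<open>T - z\<close> and \<open>T - cnj z\<close>, and it is invertible on \<open>H\<close> if and only if it is
  invertible on \<open>H\<^sub>+\<close>: an inverse on \<open>H\<close> commutes with \<open>J\<close> and hence preserves \<open>H\<^sub>+\<close>, while an
  inverse on \<open>H\<^sub>+\<close> extends to both summands. Hence \<open>q\<close> lies in the spherical spectrum if and only if
  \<open>z\<close> or \<open>cnj z\<close> lies in the spectrum of the restriction. The rest follows because \<open>\<Delta>\<^sub>q(T)\<close> depends
  only on the real part and the norm of \<open>q\<close>, and because \<open>H\<^sub>-\<close> for \<open>J\<close> is \<open>H\<^sub>+\<close> for \<open>-J\<close>.
\<close>

section \<open>Quaternions\<close>

lemma quat_sel_simps [simp]:
  "qRe 0 = 0" "qIm1 0 = 0" "qIm2 0 = 0" "qIm3 0 = 0"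
  "qRe 1 = 1" "qIm1 1 = 0" "qIm2 1 = 0" "qIm3 1 = 0"
  "qRe (p + q) = qRe p + qRe q" "qIm1 (p + q) = qIm1 p + qIm1 q"
  "qIm2 (p + q) = qIm2 p + qIm2 q" "qIm3 (p + q) = qIm3 p + qIm3 q"
  "qRe (p - q) = qRe p - qRe q" "qIm1 (p - q) = qIm1 p - qIm1 q"
  "qIm2 (p - q) = qIm2 p - qIm2 q" "qIm3 (p - q) = qIm3 p - qIm3 q"
  "qRe (- q) = - qRe q" "qIm1 (- q) = - qIm1 q"
  "qIm2 (- q) = - qIm2 q" "qIm3 (- q) = - qIm3 q"
  "qRe (r *\<^sub>R q) = r * qRe q" "qIm1 (r *\<^sub>R q) = r * qIm1 q"
  "qIm2 (r *\<^sub>R q) = r * qIm2 q" "qIm3 (r *\<^sub>R q) = r * qIm3 q"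
  "qRe (of_real r) = r" "qIm1 (of_real r) = 0" "qIm2 (of_real r) = 0" "qIm3 (of_real r) = 0"
  "qRe (qcnj q) = qRe q" "qIm1 (qcnj q) = - qIm1 q"
  "qIm2 (qcnj q) = - qIm2 q" "qIm3 (qcnj q) = - qIm3 q"
  by (simp_all add: zero_quat_def one_quat_def plus_quat_def minus_quat_def uminus_quat_def
      scaleR_quat_def of_real_def qcnj_def)

lemma quat_mult_sel:
  "qRe (p * q) = qRe p * qRe q - qIm1 p * qIm1 q - qIm2 p * qIm2 q - qIm3 p * qIm3 q"
  "qIm1 (p * q) = qRe p * qIm1 q + qIm1 p * qRe q + qIm2 p * qIm3 q - qIm3 p * qIm2 q"
  "qIm2 (p * q) = qRe p * qIm2 q - qIm1 p * qIm3 q + qIm2 p * qRe q + qIm3 p * qIm1 q"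
  "qIm3 (p * q) = qRe p * qIm3 q + qIm1 p * qIm2 q - qIm2 p * qIm1 q + qIm3 p * qRe q"
  by (simp_all add: times_quat_def)

lemma qcnj_mult: "qcnj (p * q) = qcnj q * qcnj p"
  by (simp add: quat_eq_iff quat_mult_sel algebra_simps)

lemma qcnj_add: "qcnj (p + q) = qcnj p + qcnj q"
  by (simp add: quat_eq_iff)

lemma qnorm_power2: "(qnorm q)\<^sup>2 = (qRe q)\<^sup>2 + (qIm1 q)\<^sup>2 + (qIm2 q)\<^sup>2 + (qIm3 q)\<^sup>2"
  by (simp add: qnorm_def quat_mult_sel power2_eq_square)

text \<open>The vector part of \<open>q\<^sup>2\<close> is \<open>2 * qRe q\<close> times that of
  \<open>q\<close>; a nonzero real part would thus leave a real number with square -1.\<close>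

lemma imag_units_iff:
  "q \<in> imag_units \<longleftrightarrow> qRe q = 0 \<and> (qIm1 q)\<^sup>2 + (qIm2 q)\<^sup>2 + (qIm3 q)\<^sup>2 = 1"
proof
  assume "q \<in> imag_units"
  then have q: "qRe q * qRe q - qIm1 q * qIm1 q - qIm2 q * qIm2 q - qIm3 q * qIm3 q = -1"
    "qRe q * qIm1 q = 0" "qRe q * qIm2 q = 0" "qRe q * qIm3 q = 0"
    by (auto simp: imag_units_def quat_eq_iff power2_eq_square quat_mult_sel)
  have "qRe q = 0"
  proof (rule ccontr)
    assume "qRe q \<noteq> 0"
    with q have "qRe q * qRe q = -1"
      by simp
    then show False
      using zero_le_square [of "qRe q"] by linarith
  qed
  with q show "qRe q = 0 \<and> (qIm1 q)\<^sup>2 + (qIm2 q)\<^sup>2 + (qIm3 q)\<^sup>2 = 1"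
    by (simp add: power2_eq_square)
next
  assume "qRe q = 0 \<and> (qIm1 q)\<^sup>2 + (qIm2 q)\<^sup>2 + (qIm3 q)\<^sup>2 = 1"
  then show "q \<in> imag_units"
    by (simp add: imag_units_def quat_eq_iff power2_eq_square quat_mult_sel)
qed

lemma imag_units_mult_self: "q \<in> imag_units \<Longrightarrow> q * q = -1"
  by (simp add: imag_units_def power2_eq_square)

lemma imag_units_uminus: "q \<in> imag_units \<Longrightarrow> - q \<in> imag_units"
  by (simp add: imag_units_def)

lemma qcnj_imag_unit: "q \<in> imag_units \<Longrightarrow> qcnj q = - q"
  by (simp add: imag_units_iff quat_eq_iff)

text \<open>Purely imaginary quaternions anticommute when their vector parts are orthogonal, so a
  unit vector orthogonal to \<iota> works.\<close>

lemma ex_anticommuting_imag_unit: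
  assumes "\<iota> \<in> imag_units"
  obtains j where "j \<in> imag_units" "\<iota> * j = - (j * \<iota>)"
proof (cases "qIm1 \<iota> = 0 \<and> qIm2 \<iota> = 0")
  case True
  with assms show thesis
    by (intro that [of "Quat 0 1 0 0"]) (auto simp: imag_units_iff quat_eq_iff quat_mult_sel)
next
  case False
  define r where "r = sqrt ((qIm1 \<iota>)\<^sup>2 + (qIm2 \<iota>)\<^sup>2)"
  have "(qIm1 \<iota>)\<^sup>2 + (qIm2 \<iota>)\<^sup>2 \<noteq> 0"
    using False by (simp add: sum_power2_eq_zero_iff)
  then have r: "r\<^sup>2 = (qIm1 \<iota>)\<^sup>2 + (qIm2 \<iota>)\<^sup>2" "r \<noteq> 0"
    by (simp_all add: r_def)
  \<comment> \<open>The witness is the pair of the first two coordinates of \<iota>, turned by a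
    right angle and normalised by \<open>r\<close>.\<close>
  show thesis
  proof (rule that [of "Quat 0 (qIm2 \<iota> / r) (- qIm1 \<iota> / r) 0"])
    show "Quat 0 (qIm2 \<iota> / r) (- qIm1 \<iota> / r) 0 \<in> imag_units"
      using r(2) by (simp add: imag_units_iff power_divide add.commute flip: add_divide_distrib r(1))
    show "\<iota> * Quat 0 (qIm2 \<iota> / r) (- qIm1 \<iota> / r) 0 = - (Quat 0 (qIm2 \<iota> / r) (- qIm1 \<iota> / r) 0 * \<iota>)"
      using assms by (simp add: imag_units_iff quat_eq_iff quat_mult_sel algebra_simps)
  qed
qed

section \<open>The slice of an imaginary unit\<close>

lemma slice_eq_range: "slice \<iota> = range (to_slice \<iota>)"
proof -
  have "of_real \<alpha> + \<iota> * of_real \<beta> = to_slice \<iota> (Complex \<alpha> \<beta>)" for \<alpha> \<beta>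
    by (simp add: to_slice_def)
  then show ?thesis
    by (auto simp: slice_def) (metis complex.collapse)
qed

lemma of_real_quat_commute: "of_real r * q = q * (of_real r :: quat)"
  by (simp add: quat_eq_iff quat_mult_sel)

lemma to_slice_mult_commute: "to_slice \<iota> z * to_slice \<iota> w = to_slice \<iota> w * to_slice \<iota> z"
  by (simp add: to_slice_def quat_eq_iff quat_mult_sel algebra_simps)

lemma imag_unit_to_slice_commute: "\<iota> * to_slice \<iota> z = to_slice \<iota> z * \<iota>"
  by (simp add: to_slice_def quat_eq_iff quat_mult_sel algebra_simps)

context
  fixes \<iota> :: quat
  assumes iota: "\<iota> \<in> imag_units"
begin

lemma qRe_to_slice: "qRe (to_slice \<iota> z) = Re z"
  using iota by (simp add: to_slice_def quat_mult_sel imag_units_iff)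

lemma qcnj_to_slice: "qcnj (to_slice \<iota> z) = to_slice \<iota> (cnj z)"
  using iota by (simp add: to_slice_def quat_eq_iff quat_mult_sel imag_units_iff)

lemma qnorm_to_slice: "(qnorm (to_slice \<iota> z))\<^sup>2 = (cmod z)\<^sup>2"
proof -
  have "(qnorm (to_slice \<iota> z))\<^sup>2 =
      (Re z)\<^sup>2 + ((qIm1 \<iota>)\<^sup>2 + (qIm2 \<iota>)\<^sup>2 + (qIm3 \<iota>)\<^sup>2) * (Im z)\<^sup>2"
    using iota [unfolded imag_units_iff, THEN conjunct1] unfolding qnorm_power2
    by (simp add: to_slice_def quat_mult_sel power_mult_distrib distrib_right)
  then show ?thesis
    using iota by (metis imag_units_iff mult_1 cmod_power2)
qed

lemma to_slice_mult_cnj: "to_slice \<iota> z * to_slice \<iota> (cnj z) = of_real ((cmod z)\<^sup>2)"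
proof -
  have "to_slice \<iota> z * to_slice \<iota> (cnj z) = of_real ((qnorm (to_slice \<iota> z))\<^sup>2)"
    unfolding qnorm_power2 qcnj_to_slice [symmetric]
    by (simp add: quat_eq_iff quat_mult_sel power2_eq_square)
  then show ?thesis
    by (simp add: qnorm_to_slice)
qed

lemma inj_to_slice: "inj (to_slice \<iota>)"
proof (rule injI)
  fix z w
  assume eq: "to_slice \<iota> z = to_slice \<iota> w"
  then have Re: "Re z = Re w"
    by (metis qRe_to_slice)
  with eq have "\<iota> * of_real (Im z) = \<iota> * of_real (Im w)"
    by (simp add: to_slice_def)
  then have "(\<iota> * \<iota>) * of_real (Im z) = (\<iota> * \<iota>) * of_real (Im w)"
    by (simp add: mult.assoc)
  then have "Im z = Im w"
    using iota by (simp add: imag_units_mult_self)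
  with Re show "z = w"
    by (rule complex_eqI)
qed

text \<open>Commuting quaternions have vector parts with zero cross product, so the vector part of
  \<open>q\<close> is a real multiple of \<iota>.\<close>

lemma commute_imag_unit_in_slice:
  assumes "\<iota> * q = q * \<iota>"
  shows "q \<in> range (to_slice \<iota>)"
proof -
  \<comment> \<open>The coefficient along the unit vector \<iota> is the scalar product of the
    vector parts.\<close>
  define t where "t = qIm1 \<iota> * qIm1 q + qIm2 \<iota> * qIm2 q + qIm3 \<iota> * qIm3 q"
  have "qRe \<iota> = 0" and unit: "qIm1 \<iota> * qIm1 \<iota> + qIm2 \<iota> * qIm2 \<iota> + qIm3 \<iota> * qIm3 \<iota> = 1"
    using iota by (simp_all add: imag_units_iff power2_eq_square)
  moreover have "qIm2 \<iota> * qIm3 q = qIm3 \<iota> * qIm2 q" "qIm1 \<iota> * qIm3 q = qIm3 \<iota> * qIm1 q"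
    "qIm1 \<iota> * qIm2 q = qIm2 \<iota> * qIm1 q"
    using assms by (simp_all add: quat_eq_iff quat_mult_sel algebra_simps)
  moreover from this unit have "qIm1 q = qIm1 \<iota> * t" "qIm2 q = qIm2 \<iota> * t" "qIm3 q = qIm3 \<iota> * t"
    unfolding t_def by algebra+
  ultimately have "q = to_slice \<iota> (Complex (qRe q) t)"
    by (simp add: to_slice_def quat_eq_iff quat_mult_sel)
  then show ?thesis
    by blast
qed

end

lemma quat_polar:
  obtains j \<beta> where "j \<in> imag_units" "q = of_real (qRe q) + j * of_real \<beta>"
proof -
  define \<beta> where "\<beta> = sqrt ((qIm1 q)\<^sup>2 + (qIm2 q)\<^sup>2 + (qIm3 q)\<^sup>2)"
  have \<beta>: "\<beta>\<^sup>2 = (qIm1 q)\<^sup>2 + (qIm2 q)\<^sup>2 + (qIm3 q)\<^sup>2"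
    by (simp add: \<beta>_def)
  show thesis
  proof (cases "\<beta> = 0")
    case True
    then have "qIm1 q = 0" "qIm2 q = 0" "qIm3 q = 0"
      using \<beta> by (simp_all add: add_nonneg_eq_0_iff)
    \<comment> \<open>A real quaternion determines no direction, so any imaginary unit serves with
      coefficient 0.\<close>
    then show thesis
      by (intro that [of "Quat 0 1 0 0" 0]) (simp_all add: imag_units_iff quat_eq_iff quat_mult_sel)
  next
    case False
    then show thesis
      by (intro that [of "Quat 0 (qIm1 q / \<beta>) (qIm2 q / \<beta>) (qIm3 q / \<beta>)" \<beta>])
        (simp_all add: imag_units_iff quat_eq_iff quat_mult_sel power_divide
          flip: add_divide_distrib \<beta>)
  qed
qed

section \<open>The scalar product and the adjoint\<close>

lemma qinner_add_left: "qinner (u + v) w = qinner u w + qinner v w"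
  by (metis qinner_commute qinner_add_right qcnj_add)

lemma qinner_qscale_left: "qinner (u \<bullet>q p) v = qcnj p * qinner u v"
  by (metis qinner_commute qinner_qscale_right qcnj_mult)

lemma qscale_uminus_right: "u \<bullet>q (- p) = - (u \<bullet>q p)"
  by (metis qscale_mult mult_minus1_right of_real_1 of_real_minus scaleR_eq_qscale scaleR_minus1_left)

lemma qscale_uminus_left: "(- u) \<bullet>q p = - (u \<bullet>q p)"
  by (metis qscale_mult mult_minus1 qscale_uminus_right qscale_one)

lemma qscale_diff_left: "(u - v) \<bullet>q p = u \<bullet>q p - v \<bullet>q p"
  by (metis diff_conv_add_uminus qscale_add_left qscale_uminus_left)

lemma qinner_uminus_left: "qinner (- u) v = - qinner u v"
  using qinner_qscale_left [of u "-1" v] by (simp add: qscale_uminus_right qscale_one quat_eq_iff quat_mult_sel)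

lemma qinner_uminus_right: "qinner u (- v) = - qinner u v"
  by (metis mult_minus1_right qinner_qscale_right qscale_one qscale_uminus_right)

lemma qinner_diff_left: "qinner (u - v) w = qinner u w - qinner v w"
  by (metis diff_conv_add_uminus qinner_add_left qinner_uminus_left)

lemma qRe_qinner_commute: "qRe (qinner u v) = qRe (qinner v u)"
  by (subst qinner_commute) simp

lemma qRe_qinner_scaleR_left: "qRe (qinner (r *\<^sub>R u) v) = r * qRe (qinner u v)"
  by (simp add: scaleR_eq_qscale qinner_qscale_left quat_mult_sel)

lemma qRe_qinner_scaleR_right: "qRe (qinner u (r *\<^sub>R v)) = r * qRe (qinner u v)"
  by (metis qRe_qinner_commute qRe_qinner_scaleR_left)

lemma power2_norm_qinner: "(norm u)\<^sup>2 = qRe (qinner u u)"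
  by (simp add: norm_eq_qinner qinner_nonneg)

lemma qinner_self: "qinner u u = of_real ((norm u)\<^sup>2)"
  using qinner_commute [of u u] by (simp add: quat_eq_iff power2_norm_qinner)

section \<open>Norm identities and Riesz representation\<close>

lemma power2_norm_add_q:
  fixes u v :: "'a::quaternionic_hilbert"
  shows "(norm (u + v))\<^sup>2 = (norm u)\<^sup>2 + 2 * qRe (qinner u v) + (norm v)\<^sup>2"
  unfolding power2_norm_qinner using qRe_qinner_commute [of u v]
  by (simp add: qinner_add_left qinner_add_right)

lemma parallelogram_law_q:
  fixes u v :: "'a::quaternionic_hilbert"
  shows "(norm (u + v))\<^sup>2 + (norm (u - v))\<^sup>2 = 2 * (norm u)\<^sup>2 + 2 * (norm v)\<^sup>2"
  using power2_norm_add_q [of u v] power2_norm_add_q [of u "- v"]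
  by (simp add: qinner_uminus_right)

text \<open>First order condition for a minimum at \<open>t = 0\<close>: for nonzero
  \<open>b\<close>, a suitable \<open>t\<close> of the opposite sign makes the quadratic
  negative.\<close>

lemma nonneg_quadratic_imp_linear_zero:
  fixes a b :: real
  assumes "\<And>t. 0 \<le> a * t\<^sup>2 + 2 * t * b" "0 \<le> a"
  shows "b = 0"
proof (rule ccontr)
  assume "b \<noteq> 0"
  \<comment> \<open>This \<open>t\<close> minimises the quadratic with \<open>a + 1\<close> in place
    of \<open>a\<close>; the shift keeps the denominator positive when \<open>a = 0\<close>.\<close>
  define t where "t = - b / (a + 1)"
  have "0 \<le> a * t\<^sup>2 + 2 * t * b"
    by (rule assms)
  also have "\<dots> \<le> (a + 1) * t\<^sup>2 + 2 * t * b"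
    by (simp add: mult_right_mono)
  also have "\<dots> = - (b\<^sup>2 / (a + 1))"
    using assms(2) by (simp add: t_def power2_eq_square)
  also have "\<dots> < 0"
    using assms(2) \<open>b \<noteq> 0\<close> by simp
  finally show False
    by simp
qed

text \<open>The triangle inequality comes with the \<open>banach\<close> class; expanding the
  squares of its two sides leaves this bound.\<close>

lemma Cauchy_Schwarz_q:
  fixes u v :: "'a::quaternionic_hilbert"
  shows "qRe (qinner u v) \<le> norm u * norm v"
proof -
  have "(norm (u + v))\<^sup>2 \<le> (norm u + norm v)\<^sup>2"
    by (simp add: norm_triangle_ineq power_mono)
  then show ?thesis
    by (simp add: power2_norm_add_q power2_sum)
qed

lemma abs_qRe_qinner_le:
  fixes u v :: "'a::quaternionic_hilbert"
  shows "\<bar>qRe (qinner u v)\<bar> \<le> norm u * norm v"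
  using Cauchy_Schwarz_q [of u v] Cauchy_Schwarz_q [of u "- v"]
  by (simp add: qinner_uminus_right)

text \<open>The representing vector is the minimum of \<open>(norm v)\<^sup>2 - 2 * f v\<close>; the parallelogram law makes
  minimizing sequences Cauchy.\<close>

lemma Riesz_real:
  fixes f :: "'a::quaternionic_hilbert \<Rightarrow> real"
  assumes "bounded_linear f"
  obtains w where "\<And>v. f v = qRe (qinner w v)"
proof -
  interpret f: bounded_linear f
    by fact
  define g where "g v = (norm v)\<^sup>2 - 2 * f v" for v
  obtain K where K: "\<And>v. norm (f v) \<le> norm v * K"
    using f.bounded by blast
  \<comment> \<open>Completing the square: \<open>2 * f v\<close> is at most
    \<open>2 * K * norm v\<close>, hence at most
    \<open>(norm v)\<^sup>2 + K\<^sup>2\<close>.\<close>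
  have "- K\<^sup>2 \<le> g v" for v
  proof -
    have "f v \<le> norm v * K"
      using K [of v] by simp
    moreover have "0 \<le> (norm v - K)\<^sup>2"
      by simp
    ultimately show ?thesis
      by (simp add: g_def power2_diff)
  qed
  then have bdd: "bdd_below (range g)"
    by (rule bdd_belowI2)
  define m where "m = Inf (range g)"
  have m_le: "m \<le> g v" for v
    unfolding m_def by (rule cInf_lower) (use bdd in auto)
  have "\<exists>v. g v < m + 1 / real (Suc n)" for n
    using cInf_lessD [of "range g" "m + 1 / real (Suc n)"] by (auto simp: m_def)
  then obtain V where V: "\<And>n. g (V n) < m + 1 / real (Suc n)"
    by metis
  \<comment> \<open>The midpoint of \<open>u\<close> and \<open>v\<close> has \<open>g\<close>-value
    at least \<open>m\<close>; the parallelogram law turns this into a bound on their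
    distance.\<close>
  have dist_le: "(norm (u - v))\<^sup>2 \<le> 2 * g u + 2 * g v - 4 * m" for u v
  proof -
    have "4 * g ((1/2) *\<^sub>R (u + v)) = (norm (u + v))\<^sup>2 - 4 * (f u + f v)"
      by (simp add: g_def f.scaleR f.add power_mult_distrib power_divide add_divide_distrib)
    moreover have "(norm (u + v))\<^sup>2 + (norm (u - v))\<^sup>2 = 2 * (norm u)\<^sup>2 + 2 * (norm v)\<^sup>2"
      by (rule parallelogram_law_q)
    moreover have "m \<le> g ((1/2) *\<^sub>R (u + v))"
      by (rule m_le)
    ultimately show ?thesis
      unfolding g_def [of u] g_def [of v] right_diff_distrib distrib_left by linarith
  qed
  have "Cauchy V"
  proof (rule CauchyI)
    fix e :: real
    assume "0 < e"
    then have "0 < e\<^sup>2 / 4"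
      by simp
    \<comment> \<open>\<open>dist_le\<close> doubles both excesses over \<open>m\<close>, so
      excesses below \<open>e\<^sup>2 / 4\<close> give a squared distance below
      \<open>e\<^sup>2\<close>.\<close>
    then obtain N where N: "1 / real (Suc N) < e\<^sup>2 / 4"
      by (rule nat_approx_posE)
    have "norm (V k - V l) < e" if "k \<ge> N" "l \<ge> N" for k l
    proof -
      have "1 / real (Suc n) \<le> 1 / real (Suc N)" if "n \<ge> N" for n
        using that by (simp add: frac_le)
      then have "g (V k) - m < e\<^sup>2 / 4" "g (V l) - m < e\<^sup>2 / 4"
        using V [of k] V [of l] N that by fastforce+
      then have "(norm (V k - V l))\<^sup>2 < e\<^sup>2"
        using dist_le [of "V k" "V l"] by linarith
      then show ?thesis
        using \<open>0 < e\<close> by (simp add: power2_less_imp_less)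
    qed
    then show "\<exists>N. \<forall>k\<ge>N. \<forall>l\<ge>N. norm (V k - V l) < e"
      by blast
  qed
  then obtain w where w: "V \<longlonglongrightarrow> w"
    by (auto simp: Cauchy_convergent_iff convergent_def)
  have "(\<lambda>n. g (V n)) \<longlonglongrightarrow> g w"
    unfolding g_def by (intro tendsto_intros f.tendsto w)
  moreover have "(\<lambda>n. m + 1 / real (Suc n)) \<longlonglongrightarrow> m + 0"
    by (intro tendsto_add tendsto_const LIMSEQ_Suc lim_1_over_n)
  ultimately have "g w \<le> m + 0"
    by (rule LIMSEQ_le) (use V less_imp_le in blast)
  then have "g w \<le> m"
    by simp
  \<comment> \<open>Along each line through \<open>w\<close> the increment of \<open>g\<close> is a
    quadratic in \<open>t\<close> without constant term, and minimality makes it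
    nonnegative.\<close>
  have "qRe (qinner w v) - f v = 0" for v
  proof (rule nonneg_quadratic_imp_linear_zero [of "(norm v)\<^sup>2"])
    fix t
    have "g w \<le> g (w + t *\<^sub>R v)"
      using \<open>g w \<le> m\<close> m_le order_trans by blast
    then show "0 \<le> (norm v)\<^sup>2 * t\<^sup>2 + 2 * t * (qRe (qinner w v) - f v)"
      by (simp add: g_def power2_norm_add_q f.add f.scaleR qRe_qinner_scaleR_right
          power_mult_distrib algebra_simps)
  qed simp
  then show thesis
    by (intro that [of w]) simp
qed

section \<open>Scalar multiples and the adjoint\<close>

lemma norm_qscale: "norm (u \<bullet>q p) = norm u * qnorm p"
proof (rule power2_eq_imp_eq)
  have "(norm (u \<bullet>q p))\<^sup>2 = qRe (qcnj p * (of_real ((norm u)\<^sup>2) * p))"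
    by (simp only: power2_norm_qinner [of "u \<bullet>q p"] qinner_qscale_left qinner_qscale_right
        qinner_self [of u] mult.assoc)
  also have "\<dots> = (norm u * qnorm p)\<^sup>2"
    unfolding power_mult_distrib qnorm_power2
    by (simp add: quat_mult_sel power2_eq_square algebra_simps del: of_real_mult of_real_power)
  finally show "(norm (u \<bullet>q p))\<^sup>2 = (norm u * qnorm p)\<^sup>2" .
qed (simp_all add: qnorm_def quat_mult_sel)

lemma qscale_of_real_mult: "u \<bullet>q (of_real r * p) = r *\<^sub>R (u \<bullet>q p)"
  by (simp only: of_real_quat_commute [of r p] scaleR_eq_qscale qscale_mult)

lemma qscale_scaleR_left: "(r *\<^sub>R u) \<bullet>q p = r *\<^sub>R (u \<bullet>q p)"
  by (simp only: scaleR_eq_qscale [of r u] qscale_mult [symmetric] qscale_of_real_mult)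

lemma bounded_linear_qscale: "bounded_linear (\<lambda>u::'a::quaternionic_hilbert. u \<bullet>q p)"
  by (rule bounded_linear_intro [where K = "qnorm p"])
    (simp_all add: qscale_add_left qscale_scaleR_left norm_qscale)

text \<open>Multiplying by 1 and by the three basis units brings each component, up to sign, into
  the real part. This lifts identities of real parts to identities of quaternions.\<close>

lemma qRe_mult_eq_imp_eq:
  assumes "\<And>p. qRe (a * p) = qRe (b * p)"
  shows "a = b"
  using assms [of 1] assms [of "Quat 0 1 0 0"] assms [of "Quat 0 0 1 0"] assms [of "Quat 0 0 0 1"]
  by (simp add: quat_eq_iff quat_mult_sel)

lemma qinner_eqI:
  assumes "\<And>v. qRe (qinner a v) = qRe (qinner b v)"
  shows "a = b"
proof -
  have "qRe (qinner (a - b) (a - b)) = 0"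
    using assms [of "a - b"] by (simp add: qinner_diff_left)
  then show ?thesis
    by (simp flip: power2_norm_qinner)
qed

lemma qoperators_bounded_linear: "T \<in> qoperators \<Longrightarrow> bounded_linear T"
  and qoperators_qscale: "T \<in> qoperators \<Longrightarrow> T (u \<bullet>q q) = T u \<bullet>q q"
  by (simp_all add: qoperators_def)

lemma qoperatorsI:
  assumes "\<And>u v. S (u + v) = S u + S v" "\<And>u q. S (u \<bullet>q q) = S u \<bullet>q q"
    and "\<And>u. norm (S u) \<le> norm u * C"
  shows "S \<in> qoperators"
proof -
  have "bounded_linear S"
    by (rule bounded_linear_intro [where K = C]) (simp_all add: assms scaleR_eq_qscale)
  with assms show ?thesis
    by (simp add: qoperators_def)
qed

text \<open>Riesz representation of the real part of \<open>qinner u (T v)\<close> yields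
  \<open>S u\<close>; nondegeneracy of the real form then forces \<open>S\<close> to be additive and
  right linear.\<close>

lemma ex_qadjoint:
  assumes T: "T \<in> qoperators"
  shows "\<exists>S. S \<in> qoperators \<and> (\<forall>u v. qinner (S u) v = qinner u (T v))"
proof -
  interpret T: bounded_linear T
    using T by (rule qoperators_bounded_linear)
  obtain K where K: "0 \<le> K" "\<And>v. norm (T v) \<le> norm v * K"
    using T.nonneg_bounded by blast
  have "\<exists>w. \<forall>v. qRe (qinner u (T v)) = qRe (qinner w v)" for u
  proof -
    have "bounded_linear (\<lambda>v. qRe (qinner u (T v)))"
    proof (rule bounded_linear_intro)
      show "norm (qRe (qinner u (T v))) \<le> norm v * (norm u * K)" for v
      proof -
        have "\<bar>qRe (qinner u (T v))\<bar> \<le> norm u * norm (T v)"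
          by (rule abs_qRe_qinner_le)
        also have "\<dots> \<le> norm u * (norm v * K)"
          by (intro mult_left_mono K) simp
        finally show ?thesis
          by (simp add: ac_simps)
      qed
    qed (simp_all add: T.add T.scaleR qinner_add_right qRe_qinner_scaleR_right)
    then show ?thesis
      by (metis Riesz_real)
  qed
  then obtain S where S: "\<And>u v. qRe (qinner (S u) v) = qRe (qinner u (T v))"
    by metis
  \<comment> \<open>Replacing \<open>v\<close> by \<open>v \<bullet>q p\<close> recovers the full
    quaternion from its real part.\<close>
  have adj: "qinner (S u) v = qinner u (T v)" for u v
  proof (rule qRe_mult_eq_imp_eq)
    show "qRe (qinner (S u) v * p) = qRe (qinner u (T v) * p)" for p
      using S [of u "v \<bullet>q p"] by (simp add: qoperators_qscale [OF T] qinner_qscale_right)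
  qed
  have "S \<in> qoperators"
  proof (rule qoperatorsI)
    show "S (u + v) = S u + S v" for u v
      by (rule qinner_eqI) (simp add: adj qinner_add_left)
    show "S (u \<bullet>q q) = S u \<bullet>q q" for u q
      by (rule qinner_eqI) (simp add: adj qinner_qscale_left)
    \<comment> \<open>Testing with \<open>v = S u\<close> bounds the square of
      \<open>norm (S u)\<close>; one factor is cancelled when it is nonzero.\<close>
    show "norm (S u) \<le> norm u * K" for u
    proof (cases "S u = 0")
      case False
      have "(norm (S u))\<^sup>2 = qRe (qinner u (T (S u)))"
        by (simp add: power2_norm_qinner S)
      also have "\<dots> \<le> norm u * norm (T (S u))"
        by (rule Cauchy_Schwarz_q)
      also have "\<dots> \<le> norm u * (norm (S u) * K)"
        by (intro mult_left_mono K) simp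
      finally have "norm (S u) * norm (S u) \<le> norm (S u) * (norm u * K)"
        by (simp add: power2_eq_square ac_simps)
      with False show ?thesis
        by simp
    qed (simp add: K)
  qed
  with adj show ?thesis
    by blast
qed

lemma qadjoint:
  assumes "T \<in> qoperators"
  shows qadjoint_in_qoperators: "qadjoint T \<in> qoperators"
    and qinner_qadjoint: "qinner (qadjoint T u) v = qinner u (T v)"
proof -
  have "\<exists>!S. S \<in> qoperators \<and> (\<forall>u v. qinner (S u) v = qinner u (T v))"
  proof (rule ex_ex1I [OF ex_qadjoint [OF assms]])
    show "S = S'" if "S \<in> qoperators \<and> (\<forall>u v. qinner (S u) v = qinner u (T v))"
      and "S' \<in> qoperators \<and> (\<forall>u v. qinner (S' u) v = qinner u (T v))" for S S'
      using that by (intro ext qinner_eqI) simp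
  qed
  from theI' [OF this]
  show "qadjoint T \<in> qoperators" "qinner (qadjoint T u) v = qinner u (T v)"
    by (simp_all add: qadjoint_def)
qed


section \<open>The operator $\Delta_q(T)$\<close>

text \<open>Both coefficients are real, which lets \<open>Delta q T\<close> pass through every
  bounded real-linear map commuting with \<open>T\<close>.\<close>

lemma Delta_eq:
  "Delta q T u = T (T u) - (2 * qRe q) *\<^sub>R T u + (qnorm q)\<^sup>2 *\<^sub>R u"
proof -
  have "q + qcnj q = of_real (2 * qRe q)"
    by (simp add: quat_eq_iff del: of_real_mult)
  then show ?thesis
    by (simp only: Delta_def scaleR_eq_qscale)
qed

lemma spherical_spectrum_cong:
  assumes "qRe p = qRe q" "(qnorm p)\<^sup>2 = (qnorm q)\<^sup>2"
  shows "p \<in> spherical_spectrum T \<longleftrightarrow> q \<in> spherical_spectrum T"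
proof -
  have "Delta p T = Delta q T"
    by (rule ext) (simp add: Delta_eq assms)
  then show ?thesis
    by (simp add: spherical_spectrum_def)
qed

lemma spherical_spectrum_to_slice_cong:
  assumes "i \<in> imag_units" "j \<in> imag_units" "Re z = Re w" "cmod z = cmod w"
  shows "to_slice i z \<in> spherical_spectrum T \<longleftrightarrow> to_slice j w \<in> spherical_spectrum T"
  using assms by (intro spherical_spectrum_cong) (simp_all add: qRe_to_slice qnorm_to_slice)

lemma Delta_commute:
  assumes "bounded_linear S" "\<And>u. S (T u) = T (S u)"
  shows "S (Delta q T u) = Delta q T (S u)"
proof -
  interpret S: bounded_linear S by fact
  show ?thesis
    by (simp add: Delta_eq S.add S.diff S.scaleR assms(2))
qed

lemma Delta_add:
  assumes "bounded_linear T"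
  shows "Delta q T (u + v) = Delta q T u + Delta q T v"
proof -
  interpret T: bounded_linear T by fact
  show ?thesis
    by (simp add: Delta_eq T.add algebra_simps)
qed

lemma Delta_qscale:
  assumes "T \<in> qoperators"
  shows "Delta q T (u \<bullet>q p) = Delta q T u \<bullet>q p"
  using assms
  by (simp add: Delta_eq qoperators_qscale qscale_add_left qscale_diff_left qscale_scaleR_left)

text \<open>For \<open>q = to_slice \<iota> z\<close> the two scalars are \<open>q\<close> and
  \<open>qcnj q\<close>: their sum is the linear coefficient and their product the constant
  one.\<close>

lemma Delta_factorization:
  assumes "T \<in> qoperators" "\<iota> \<in> imag_units"
  shows "T (T u - u \<bullet>q to_slice \<iota> (cnj z)) - (T u - u \<bullet>q to_slice \<iota> (cnj z)) \<bullet>q to_slice \<iota> z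
    = Delta (to_slice \<iota> z) T u"
proof -
  interpret T: bounded_linear T
    using assms(1) by (rule qoperators_bounded_linear)
  have "u \<bullet>q to_slice \<iota> (cnj z) \<bullet>q to_slice \<iota> z = u \<bullet>q of_real ((qnorm (to_slice \<iota> z))\<^sup>2)"
    using assms(2)
    by (simp only: qscale_mult [symmetric] to_slice_mult_commute [of \<iota> "cnj z"]
        to_slice_mult_cnj qnorm_to_slice)
  then show ?thesis
    using assms
    by (simp add: Delta_def T.diff qoperators_qscale qscale_diff_left qscale_add_right qcnj_to_slice)
qed

text \<open>What commutes with \<open>T\<close> commutes with \<open>Delta q T\<close> and so with
  its inverse. Used with \<open>A\<close> equal to \<open>J\<close> and to \<open>T\<close>.\<close>

lemma Delta_inverse_commute:
  assumes "S \<circ> Delta q T = id" "Delta q T \<circ> S = id"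
    and "bounded_linear A" "\<And>u. A (T u) = T (A u)"
  shows "S (A u) = A (S u)"
proof -
  have "S (A u) = S (A (Delta q T (S u)))"
    using assms(2) by (metis comp_apply id_apply)
  also have "\<dots> = S (Delta q T (A (S u)))"
    using assms(3,4) by (simp add: Delta_commute)
  also have "\<dots> = A (S u)"
    using assms(1) by (metis comp_apply id_apply)
  finally show ?thesis .
qed

section \<open>The complex subspace\<close>

text \<open>The assumptions on \<open>J\<close> are stable under passing to \<open>- J\<close>, so
  that results for \<open>H_plus\<close> carry over to \<open>H_minus\<close>.\<close>

locale qcomplex_structure =
  fixes J :: "'a::quaternionic_hilbert \<Rightarrow> 'a" and \<iota> :: quat
  assumes J_operator: "J \<in> qoperators"
    and J_J: "J (J u) = - u"
    and J_skew: "qinner (J u) v = - qinner u (J v)"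
    and iota: "\<iota> \<in> imag_units"
begin

sublocale J: bounded_linear J
  using J_operator by (rule qoperators_bounded_linear)

abbreviation E :: "'a complex_space" where
  "E \<equiv> H_plus J \<iota>"

lemma Carrier_E_iff: "u \<in> Carrier E \<longleftrightarrow> J u = u \<bullet>q \<iota>"
  by (simp add: H_plus_def)

lemma cscale_E [simp]: "cscale E z u = u \<bullet>q to_slice \<iota> z"
  by (simp add: H_plus_def)

lemma Carrier_E_add: "u \<in> Carrier E \<Longrightarrow> v \<in> Carrier E \<Longrightarrow> u + v \<in> Carrier E"
  by (simp add: Carrier_E_iff J.add qscale_add_left)

lemma Carrier_E_diff: "u \<in> Carrier E \<Longrightarrow> v \<in> Carrier E \<Longrightarrow> u - v \<in> Carrier E"
  by (simp add: Carrier_E_iff J.diff qscale_diff_left)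

lemma Carrier_E_qscale: "u \<in> Carrier E \<Longrightarrow> u \<bullet>q to_slice \<iota> z \<in> Carrier E"
  using J_operator
  by (simp add: Carrier_E_iff qoperators_qscale imag_unit_to_slice_commute flip: qscale_mult)

lemma Carrier_E_invariant:
  assumes "S \<in> qoperators" "\<And>u. S (J u) = J (S u)" "u \<in> Carrier E"
  shows "S u \<in> Carrier E"
  using assms by (metis Carrier_E_iff qoperators_qscale)

text \<open>On the carrier, skewness of \<open>J\<close> says that \<open>qinner u v\<close>
  commutes with \<iota>. Hence the value lies in the slice, where
  \<open>inv (to_slice \<iota>)\<close> is a genuine inverse.\<close>

lemma to_slice_cinner:
  assumes "u \<in> Carrier E" "v \<in> Carrier E"
  shows "to_slice \<iota> (cinner E u v) = qinner u v"
proof -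
  have "\<iota> * qinner u v = qinner u v * \<iota>"
    using J_skew [of u v] assms iota
    by (simp add: Carrier_E_iff qinner_qscale_left qinner_qscale_right qcnj_imag_unit)
  then have "qinner u v \<in> range (to_slice \<iota>)"
    using iota by (rule commute_imag_unit_in_slice [rotated])
  then show ?thesis
    by (simp add: H_plus_def f_inv_into_f)
qed

lemma cnorm_E: "u \<in> Carrier E \<Longrightarrow> cnorm E u = norm u"
  using qRe_to_slice [OF iota] by (simp add: cnorm_def norm_eq_qinner flip: to_slice_cinner)

text \<open>The condition on scalars is stated for the slice so as to cover the inverse of
  \<open>T - z\<close>, which involves right multiplication by a slice element and need not be right
  linear over \<open>quat\<close>.\<close>

lemma restrict_in_coperators:
  assumes "bounded_linear f" "\<And>u. u \<in> Carrier E \<Longrightarrow> f u \<in> Carrier E"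
    and "\<And>z u. f (u \<bullet>q to_slice \<iota> z) = f u \<bullet>q to_slice \<iota> z"
  shows "restrict f (Carrier E) \<in> coperators E"
proof -
  interpret f: bounded_linear f by fact
  obtain K where "\<And>u. norm (f u) \<le> norm u * K"
    using f.bounded by blast
  then have "\<forall>u\<in>Carrier E. cnorm E (restrict f (Carrier E) u) \<le> K * cnorm E u"
    using assms(2) by (simp add: cnorm_E mult.commute)
  then show ?thesis
    using assms unfolding coperators_def
    by (auto simp: Carrier_E_add Carrier_E_qscale f.add)
qed

lemma restrict_qoperator_in_coperators:
  assumes "S \<in> qoperators" "\<And>u. S (J u) = J (S u)"
  shows "restrict S (Carrier E) \<in> coperators E"
  using assms
  by (intro restrict_in_coperators)
    (simp_all add: qoperators_bounded_linear qoperators_qscale Carrier_E_invariant)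

lemma coperators_closed: "A \<in> coperators E \<Longrightarrow> u \<in> Carrier E \<Longrightarrow> A u \<in> Carrier E"
  by (auto simp: coperators_def)

lemma coperators_bounded:
  assumes "A \<in> coperators E"
  obtains C where "0 \<le> C" "\<And>u. u \<in> Carrier E \<Longrightarrow> norm (A u) \<le> C * norm u"
proof -
  obtain C where C: "\<And>u. u \<in> Carrier E \<Longrightarrow> cnorm E (A u) \<le> C * cnorm E u"
    using assms unfolding coperators_def by blast
  have "norm (A u) \<le> \<bar>C\<bar> * norm u" if "u \<in> Carrier E" for u
  proof -
    have "norm (A u) \<le> C * norm u"
      using C [OF that] assms that by (simp add: cnorm_E coperators_closed)
    also have "\<dots> \<le> \<bar>C\<bar> * norm u"
      by (simp add: mult_right_mono)
    finally show ?thesis .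
  qed
  then show thesis
    by (intro that [of "\<bar>C\<bar>"]) simp_all
qed

text \<open>The adjoint relation restricts because \<open>cinner E\<close> transports
  \<open>qinner\<close>. For uniqueness, the difference of two candidate values stays in the carrier
  and is tested against itself.\<close>

lemma cadjoint_restrict:
  assumes T: "T \<in> qoperators" "\<And>u. T (J u) = J (T u)"
    and adj: "\<And>u. qadjoint T (J u) = J (qadjoint T u)"
  shows "cadjoint E (restrict T (Carrier E)) = restrict (qadjoint T) (Carrier E)"
  unfolding cadjoint_def
proof (rule the_equality)
  let ?A = "restrict T (Carrier E)" and ?B = "restrict (qadjoint T) (Carrier E)"
  have B: "?B \<in> coperators E"
    using adj qadjoint_in_qoperators [OF T(1)] by (intro restrict_qoperator_in_coperators)
  have cinner_B: "cinner E (?B u) v = cinner E u (?A v)" if "u \<in> Carrier E" "v \<in> Carrier E" for u v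
  proof (rule injD [OF inj_to_slice [OF iota]])
    show "to_slice \<iota> (cinner E (?B u) v) = to_slice \<iota> (cinner E u (?A v))"
      using that T adj qadjoint_in_qoperators [OF T(1)]
      by (simp add: to_slice_cinner Carrier_E_invariant qinner_qadjoint)
  qed
  with B show "?B \<in> coperators E \<and> (\<forall>u\<in>Carrier E. \<forall>v\<in>Carrier E.
      cinner E (?B u) v = cinner E u (?A v))"
    by blast
  fix B'
  assume B': "B' \<in> coperators E \<and> (\<forall>u\<in>Carrier E. \<forall>v\<in>Carrier E.
      cinner E (B' u) v = cinner E u (?A v))"
  show "B' = ?B"
  proof (rule extensionalityI)
    show "B' \<in> extensional (Carrier E)" "?B \<in> extensional (Carrier E)"
      using B' by (auto simp: coperators_def PiE_def)
    fix u
    assume u: "u \<in> Carrier E"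
    then have "B' u \<in> Carrier E" "?B u \<in> Carrier E"
      using B B' coperators_closed by blast+
    moreover from this have "B' u - ?B u \<in> Carrier E"
      by (rule Carrier_E_diff)
    ultimately have "qinner (B' u) (B' u - ?B u) = qinner (?B u) (B' u - ?B u)"
      using B' cinner_B u by (metis to_slice_cinner)
    then have "qinner (B' u - ?B u) (B' u - ?B u) = 0"
      by (simp only: qinner_diff_left diff_self)
    then show "B' u = ?B u"
      using qinner_eq_zero by fastforce
  qed
qed

section \<open>Projection onto the complex subspace\<close>

definition proj :: "'a \<Rightarrow> 'a" where
  "proj x = (1 / 2) *\<^sub>R (x - J x \<bullet>q \<iota>)"

lemma bounded_linear_proj: "bounded_linear proj"
  unfolding proj_def
  by (intro bounded_linear_compose [OF bounded_linear_scaleR_right] bounded_linear_sub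
      bounded_linear_ident bounded_linear_compose [OF bounded_linear_qscale] J.bounded_linear)

lemma qscale_iota_iota: "u \<bullet>q \<iota> \<bullet>q \<iota> = - u"
  using iota by (simp add: imag_units_mult_self qscale_uminus_right qscale_one flip: qscale_mult)

text \<open>Sending \<open>x\<close> to \<open>- (J x \<bullet>q \<iota>)\<close> is an involution
  whose fixed vectors form the carrier; \<open>proj\<close> averages it with the identity.\<close>

lemma proj_in_Carrier: "proj x \<in> Carrier E"
  using J_operator
  by (simp add: Carrier_E_iff proj_def J.scaleR J.diff qoperators_qscale J_J
      qscale_uminus_left qscale_scaleR_left qscale_diff_left qscale_iota_iota add.commute)

text \<open>The remainder is the same average with the opposite sign, which lands in the carrier of
  \<open>H_minus J \<iota>\<close>.\<close>

lemma J_minus_proj: "J (x - proj x) = - ((x - proj x) \<bullet>q \<iota>)"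
proof -
  have "x - proj x = (1 / 2) *\<^sub>R (x + J x \<bullet>q \<iota>)"
    unfolding proj_def by (simp add: algebra_simps flip: scaleR_add_left)
  then show ?thesis
    using J_operator
    by (simp add: J.scaleR J.add qoperators_qscale J_J qscale_uminus_left qscale_scaleR_left
        qscale_add_left qscale_iota_iota flip: scaleR_minus_right)
qed

text \<open>Right multiplication by an imaginary unit anticommuting with \<open>\<iota>\<close> exchanges the two
  eigenspaces of \<open>J\<close>, so \<open>x = u + v \<bullet>q j\<close> with \<open>u\<close>, \<open>v\<close> in the complex subspace.\<close>

lemma minus_proj_qscale_in_Carrier:
  assumes "\<iota> * j = - (j * \<iota>)"
  shows "(x - proj x) \<bullet>q j \<in> Carrier E"
proof -
  have "J ((x - proj x) \<bullet>q j) = (x - proj x) \<bullet>q (- (\<iota> * j))"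
    using J_operator
    by (simp only: qoperators_qscale J_minus_proj qscale_uminus_left qscale_uminus_right qscale_mult)
  then show ?thesis
    by (simp only: Carrier_E_iff assms minus_minus qscale_mult)
qed

text \<open>If \<open>S\<close> inverts \<open>Delta\<close>, cancelling one factor of the
  factorization leaves \<open>S\<close> after \<open>T - cnj z\<close> as the inverse of
  \<open>T - z\<close> on the carrier.\<close>

lemma not_in_cspectrum:
  assumes T: "T \<in> qoperators" "\<And>u. T (J u) = J (T u)"
    and z: "to_slice \<iota> z \<notin> spherical_spectrum T"
  shows "z \<notin> cspectrum E (restrict T (Carrier E))"
proof -
  let ?q = "to_slice \<iota> z" and ?w = "to_slice \<iota> (cnj z)"
  obtain S where S: "S \<in> qoperators" "S \<circ> Delta ?q T = id" "Delta ?q T \<circ> S = id"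
    using z by (auto simp: spherical_spectrum_def)
  interpret T: bounded_linear T
    using T(1) by (rule qoperators_bounded_linear)
  interpret S: bounded_linear S
    using S(1) by (rule qoperators_bounded_linear)
  \<comment> \<open>Commutation with \<open>J\<close> keeps the carrier invariant under
    \<open>S\<close>; commutation with \<open>T\<close> moves \<open>S\<close> past the factor
    \<open>T - z\<close>.\<close>
  have SJ: "S (J u) = J (S u)" for u
    using S(2,3) J.bounded_linear by (rule Delta_inverse_commute) (simp add: T)
  have ST: "S (T u) = T (S u)" for u
    using S(2,3) T.bounded_linear by (rule Delta_inverse_commute) simp
  define f where "f u = S (T u - u \<bullet>q ?w)" for u
  have fE: "f u \<in> Carrier E" if "u \<in> Carrier E" for u
    unfolding f_def using that T S(1) SJ
    by (intro Carrier_E_invariant [of S] Carrier_E_diff Carrier_E_qscale Carrier_E_invariant [of T])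
  have f_op: "restrict f (Carrier E) \<in> coperators E"
  proof (rule restrict_in_coperators)
    show "bounded_linear f"
      unfolding f_def
      by (intro bounded_linear_compose [OF S.bounded_linear] bounded_linear_sub T.bounded_linear
          bounded_linear_qscale)
    show "f (u \<bullet>q to_slice \<iota> y) = f u \<bullet>q to_slice \<iota> y" for u y
      using T(1) S(1)
      by (simp add: f_def qoperators_qscale S.diff qscale_diff_left to_slice_mult_commute
          flip: qscale_mult)
  qed (rule fE)
  have T_f: "T (f u) - f u \<bullet>q ?q = u" for u
  proof -
    have "T (f u) - f u \<bullet>q ?q = S (T (T u - u \<bullet>q ?w) - (T u - u \<bullet>q ?w) \<bullet>q ?q)"
      using S(1) by (simp only: f_def ST S.diff qoperators_qscale)
    also have "\<dots> = u"
      using S(2) by (metis Delta_factorization T(1) iota comp_apply id_apply)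
    finally show ?thesis .
  qed
  \<comment> \<open>The two factors commute, so the same factorization also cancels from the other
    side.\<close>
  have f_T: "f (T u - u \<bullet>q ?q) = u" for u
  proof -
    have "T (T u - u \<bullet>q ?q) - (T u - u \<bullet>q ?q) \<bullet>q ?w = T (T u - u \<bullet>q ?w) - (T u - u \<bullet>q ?w) \<bullet>q ?q"
      using T(1) by (simp add: T.diff qoperators_qscale qscale_diff_left
          to_slice_mult_commute [of _ z] flip: qscale_mult)
    then show ?thesis
      unfolding f_def using S(2) by (metis Delta_factorization T(1) iota comp_apply id_apply)
  qed
  have "T u - u \<bullet>q ?q \<in> Carrier E" if "u \<in> Carrier E" for u
    using that T by (intro Carrier_E_diff Carrier_E_qscale Carrier_E_invariant [of T])
  then show ?thesis
    using f_op fE T_f f_T by (force simp: cspectrum_def)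
qed

text \<open>The two resolvents compose to an inverse of \<open>Delta\<close> on the carrier; as
  \<open>Delta\<close> is right linear over \<open>quat\<close>, applying this inverse to both
  components of \<open>u + v \<bullet>q j\<close> inverts it everywhere.\<close>

lemma not_in_spherical_spectrum:
  assumes T: "T \<in> qoperators" "\<And>u. T (J u) = J (T u)"
    and z: "z \<notin> cspectrum E (restrict T (Carrier E))"
      "cnj z \<notin> cspectrum E (restrict T (Carrier E))"
  shows "to_slice \<iota> z \<notin> spherical_spectrum T"
proof -
  let ?q = "to_slice \<iota> z" and ?w = "to_slice \<iota> (cnj z)"
  interpret T: bounded_linear T
    using T(1) by (rule qoperators_bounded_linear)
  interpret P: bounded_linear proj
    by (rule bounded_linear_proj)
  have TE: "T u \<in> Carrier E" if "u \<in> Carrier E" for u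
    using T that by (rule Carrier_E_invariant)
  have RE: "T u - u \<bullet>q to_slice \<iota> y \<in> Carrier E" if "u \<in> Carrier E" for u y
    using that by (intro Carrier_E_diff Carrier_E_qscale TE)
  obtain A where A: "A \<in> coperators E"
    "\<And>u. u \<in> Carrier E \<Longrightarrow> A (T u - u \<bullet>q ?q) = u"
    "\<And>u. u \<in> Carrier E \<Longrightarrow> T (A u) - A u \<bullet>q ?q = u"
    using z(1) coperators_closed by (force simp: cspectrum_def)
  obtain B where B: "B \<in> coperators E"
    "\<And>u. u \<in> Carrier E \<Longrightarrow> B (T u - u \<bullet>q ?w) = u"
    "\<And>u. u \<in> Carrier E \<Longrightarrow> T (B u) - B u \<bullet>q ?w = u"
    using z(2) coperators_closed by (force simp: cspectrum_def)
  \<comment> \<open>\<open>Delta\<close> applies \<open>T - cnj z\<close> first and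
    \<open>T - z\<close> second, so the inverses come in the opposite order.\<close>
  define G where "G u = B (A u)" for u
  have AE: "A u \<in> Carrier E" and GE: "G u \<in> Carrier E" if "u \<in> Carrier E" for u
    using A(1) B(1) that by (simp_all add: G_def coperators_closed)
  have Delta_G: "Delta ?q T (G u) = u" if "u \<in> Carrier E" for u
    using that AE by (simp add: G_def A B Delta_factorization [OF T(1) iota, symmetric])
  have G_Delta: "G (Delta ?q T u) = u" if "u \<in> Carrier E" for u
    using that RE by (simp add: G_def A B Delta_factorization [OF T(1) iota, symmetric])
  obtain a where a: "0 \<le> a" "\<And>u. u \<in> Carrier E \<Longrightarrow> norm (A u) \<le> a * norm u"
    using A(1) coperators_bounded by blast
  obtain b where b: "0 \<le> b" "\<And>u. u \<in> Carrier E \<Longrightarrow> norm (B u) \<le> b * norm u"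
    using B(1) coperators_bounded by blast
  have norm_G: "norm (G u) \<le> b * a * norm u" if "u \<in> Carrier E" for u
  proof -
    have "norm (G u) \<le> b * norm (A u)"
      unfolding G_def using that by (intro b AE)
    also have "\<dots> \<le> b * (a * norm u)"
      using that by (intro mult_left_mono a b)
    finally show ?thesis
      by simp
  qed
  obtain j where j: "j \<in> imag_units" "\<iota> * j = - (j * \<iota>)"
    using iota by (rule ex_anticommuting_imag_unit)
  \<comment> \<open>Since \<open>- j\<close> inverts \<open>j\<close>, this is the component
    \<open>v\<close> in \<open>x = u + v \<bullet>q j\<close> with
    \<open>u = proj x\<close>.\<close>
  define Q where "Q x = (x - proj x) \<bullet>q (- j)" for x
  have QE: "Q x \<in> Carrier E" for x
    unfolding Q_def using j(2) by (intro minus_proj_qscale_in_Carrier) simp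
  have decomp: "proj x + Q x \<bullet>q j = x" for x
    using j(1) by (simp add: Q_def imag_units_mult_self qscale_one flip: qscale_mult)
  have norm_j: "norm (u \<bullet>q j) = norm u" "norm (u \<bullet>q (- j)) = norm u" for u :: 'a
  proof -
    have "(qnorm j)\<^sup>2 = 1"
      using j(1) by (simp add: imag_units_iff qnorm_power2)
    moreover have "0 \<le> qnorm j"
      by (simp add: qnorm_def quat_mult_sel)
    ultimately have "qnorm j = 1"
      using power2_eq_1_iff [of "qnorm j"] by linarith
    then show "norm (u \<bullet>q j) = norm u" "norm (u \<bullet>q (- j)) = norm u"
      by (simp_all add: norm_qscale qscale_uminus_right)
  qed
  \<comment> \<open>\<open>T\<close> commutes with \<open>J\<close> and with right multiplications,
    from which \<open>proj\<close> is built, so \<open>Delta\<close> respects the splitting.\<close>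
  have proj_Delta: "proj (Delta ?q T x) = Delta ?q T (proj x)" for x
    using P.bounded_linear
    by (rule Delta_commute)
      (use T in \<open>simp add: proj_def T.scaleR T.diff qoperators_qscale\<close>)
  have Q_Delta: "Q (Delta ?q T x) = Delta ?q T (Q x)" for x
  proof -
    have "Delta ?q T x - Delta ?q T (proj x) = Delta ?q T (x - proj x)"
      using Delta_add [OF T.bounded_linear, of ?q "x - proj x" "proj x"] by simp
    then show ?thesis
      using T(1) by (simp add: Q_def proj_Delta Delta_qscale)
  qed
  define S where "S x = G (proj x) + G (Q x) \<bullet>q j" for x
  have Delta_S: "Delta ?q T (S x) = x" for x
    using T(1) by (simp add: S_def Delta_add T.bounded_linear Delta_qscale Delta_G proj_in_Carrier
        QE decomp)
  have S_Delta: "S (Delta ?q T x) = x" for x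
    by (simp add: S_def proj_Delta Q_Delta G_Delta proj_in_Carrier QE decomp)
  obtain K where K: "\<And>x. norm (proj x) \<le> norm x * K"
    using P.bounded by blast
  have "S \<in> qoperators"
  proof (rule qoperatorsI)
    \<comment> \<open>Linearity is inherited from \<open>Delta\<close>, of which \<open>S\<close> is
      a two-sided inverse; the bound is read off the explicit form of \<open>S\<close>.\<close>
    show "S (u + v) = S u + S v" for u v
      by (metis S_Delta Delta_S Delta_add T.bounded_linear)
    show "S (u \<bullet>q p) = S u \<bullet>q p" for u p
      by (metis S_Delta Delta_S Delta_qscale T(1))
    \<comment> \<open>\<open>proj x\<close> contributes \<open>K\<close> and
      \<open>x - proj x\<close> contributes \<open>K + 1\<close>, while \<open>b * a\<close> bounds
      \<open>G\<close>.\<close>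
    show "norm (S x) \<le> norm x * (b * a * (2 * K + 1))" for x
    proof -
      have "norm (S x) \<le> norm (G (proj x)) + norm (G (Q x))"
        unfolding S_def by (metis norm_triangle_ineq norm_j(1))
      also have "\<dots> \<le> b * a * norm (proj x) + b * a * norm (Q x)"
        by (intro add_mono norm_G proj_in_Carrier QE)
      also have "\<dots> = b * a * (norm (proj x) + norm (x - proj x))"
        by (simp add: Q_def norm_j distrib_left)
      also have "\<dots> \<le> b * a * (norm x * (2 * K + 1))"
      proof (rule mult_left_mono)
        have "norm (x - proj x) \<le> norm x + norm (proj x)"
          by (rule norm_triangle_ineq4)
        then show "norm (proj x) + norm (x - proj x) \<le> norm x * (2 * K + 1)"
          using K [of x] by (simp add: algebra_simps)
      qed (use a b in simp)
      finally show ?thesis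
        by (simp add: ac_simps)
    qed
  qed
  moreover have "S \<circ> Delta ?q T = id" "Delta ?q T \<circ> S = id"
    by (auto simp: S_Delta Delta_S)
  ultimately show ?thesis
    by (auto simp: spherical_spectrum_def)
qed

section \<open>The spherical spectrum in terms of the complex spectrum\<close>

lemma to_slice_in_spherical_spectrum_iff:
  assumes "T \<in> qoperators" "\<And>u. T (J u) = J (T u)"
  shows "to_slice \<iota> z \<in> spherical_spectrum T \<longleftrightarrow>
    z \<in> cspectrum E (restrict T (Carrier E)) \<or> cnj z \<in> cspectrum E (restrict T (Carrier E))"
proof -
  \<comment> \<open>Conjugation keeps the real part and the modulus, so \<open>z\<close> and
    \<open>cnj z\<close> play symmetric roles.\<close>
  have "to_slice \<iota> (cnj z) \<in> spherical_spectrum T \<longleftrightarrow> to_slice \<iota> z \<in> spherical_spectrum T"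
    using iota by (intro spherical_spectrum_to_slice_cong) simp_all
  then show ?thesis
    using not_in_cspectrum [OF assms] not_in_spherical_spectrum [OF assms] by blast
qed

lemma slice_spectrum:
  assumes "T \<in> qoperators" "\<And>u. T (J u) = J (T u)"
  shows "to_slice \<iota> ` cspectrum E (restrict T (Carrier E))
      \<union> qcnj ` to_slice \<iota> ` cspectrum E (restrict T (Carrier E)) = spherical_spectrum T \<inter> slice \<iota>"
    (is "?L = ?R")
proof (rule set_eqI)
  fix q
  show "q \<in> ?L \<longleftrightarrow> q \<in> ?R"
  \<comment> \<open>Both sides lie in the slice, so the comparison reduces to points
    \<open>to_slice \<iota> z\<close>.\<close>
  proof (cases "q \<in> range (to_slice \<iota>)")
    case True
    then obtain z where q: "q = to_slice \<iota> z"
      by blast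
    have "to_slice \<iota> z \<in> to_slice \<iota> ` A \<longleftrightarrow> z \<in> A"
      and "to_slice \<iota> z \<in> qcnj ` to_slice \<iota> ` A \<longleftrightarrow> cnj z \<in> A" for A
      using inj_to_slice [OF iota]
      by (auto simp: inj_image_mem_iff image_image qcnj_to_slice [OF iota] inj_eq
          intro: image_eqI [where x = "cnj z"])
    then show ?thesis
      using to_slice_in_spherical_spectrum_iff [OF assms] True
      by (simp add: q slice_eq_range)
  next
    case False
    then show ?thesis
      by (auto simp: slice_eq_range qcnj_to_slice [OF iota])
  qed
qed

text \<open>Every quaternion lies in the slice of some imaginary unit \<open>j\<close>, and
  replacing \<open>j\<close> by \<iota> does not affect membership in the spherical spectrum, so the
  criterion for \<iota> decides in all slices.\<close>

lemma spherical_spectrum_eq_circularization: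
  assumes "T \<in> qoperators" "\<And>u. T (J u) = J (T u)"
  shows "spherical_spectrum T = circularization (cspectrum E (restrict T (Carrier E)))"
    (is "_ = circularization ?K")
proof (rule set_eqI)
  fix q
  have circ: "q \<in> circularization ?K \<longleftrightarrow> (\<exists>j z. j \<in> imag_units \<and> z \<in> ?K \<and> q = to_slice j z)"
  proof
    assume "q \<in> circularization ?K"
    then obtain \<alpha> \<beta> j where "j \<in> imag_units" "Complex \<alpha> \<beta> \<in> ?K"
      "q = to_slice j (Complex \<alpha> \<beta>)"
      by (auto simp: circularization_def to_slice_def)
    then show "\<exists>j z. j \<in> imag_units \<and> z \<in> ?K \<and> q = to_slice j z"
      by blast
  next
    assume "\<exists>j z. j \<in> imag_units \<and> z \<in> ?K \<and> q = to_slice j z"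
    then obtain j z where "j \<in> imag_units" "z \<in> ?K"
      "q = of_real (Re z) + j * of_real (Im z)"
      by (auto simp: to_slice_def)
    moreover from this have "Complex (Re z) (Im z) \<in> ?K"
      by simp
    ultimately show "q \<in> circularization ?K"
      unfolding circularization_def by blast
  qed
  have iff: "to_slice j z \<in> spherical_spectrum T \<longleftrightarrow> z \<in> ?K \<or> cnj z \<in> ?K" if "j \<in> imag_units" for j z
    using spherical_spectrum_to_slice_cong [OF that iota, of z z T]
      to_slice_in_spherical_spectrum_iff [OF assms] by simp
  obtain j \<beta> where j: "j \<in> imag_units" "q = of_real (qRe q) + j * of_real \<beta>"
    by (rule quat_polar)
  define z where "z = Complex (qRe q) \<beta>"
  \<comment> \<open>Passing to \<open>- j\<close> conjugates \<open>z\<close>, so \<open>q\<close>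
    is reached whether \<open>z\<close> or \<open>cnj z\<close> lies in \<open>?K\<close>.\<close>
  have q: "q = to_slice j z" "q = to_slice (- j) (cnj z)"
    using j(2) by (simp_all add: z_def to_slice_def)
  show "q \<in> spherical_spectrum T \<longleftrightarrow> q \<in> circularization ?K"
  proof
    assume "q \<in> spherical_spectrum T"
    then have "z \<in> ?K \<or> cnj z \<in> ?K"
      using iff [OF j(1)] q(1) by simp
    then show "q \<in> circularization ?K"
      unfolding circ using q j(1) imag_units_uminus by blast
  next
    assume "q \<in> circularization ?K"
    then show "q \<in> spherical_spectrum T"
      unfolding circ using iff by blast
  qed
qed

end

section \<open>Both eigenspaces\<close>

lemma H_minus_eq_H_plus: "H_minus J \<iota> = H_plus (\<lambda>u. - J u) \<iota>"
proof -
  have "J u = - (u \<bullet>q \<iota>) \<longleftrightarrow> - J u = u \<bullet>q \<iota>" for u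
    by (metis minus_minus)
  then show ?thesis
    by (simp add: H_minus_def H_plus_def)
qed

text \<open>Unitarity with adjoint \<open>- J\<close> forces \<open>J\<close> to square to minus the
  identity, and the adjoint relation becomes skewness.\<close>

lemma qcomplex_structureI:
  assumes "J \<in> qoperators" "anti_self_adjoint J" "qunitary J" "\<iota> \<in> imag_units"
  shows "qcomplex_structure J \<iota>"
proof
  have adj: "qadjoint J = (\<lambda>u. - J u)"
    using assms(2) by (simp add: anti_self_adjoint_def)
  then show "J (J u) = - u" for u
  proof -
    have "- J (J u) = u"
      using assms(3) by (simp add: qunitary_def adj fun_eq_iff)
    then show ?thesis
      by (metis minus_minus)
  qed
  show "qinner (J u) v = - qinner u (J v)" for u v
  proof -
    have "- qinner (J u) v = qinner u (J v)"
      using qinner_qadjoint [OF assms(1), of u v] by (simp only: adj qinner_uminus_left)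
    then show ?thesis
      by (metis minus_minus)
  qed
qed (use assms in auto)

theorem proposition5p11:
  fixes T J :: "'a::quaternionic_hilbert \<Rightarrow> 'a"
    and \<iota> :: quat
    and E :: "'a complex_space"
  assumes "T \<in> qoperators" and "qnormal T"
    and "J \<in> qoperators" and "anti_self_adjoint J" and "qunitary J"
    and "T \<circ> J = J \<circ> T" and "qadjoint T \<circ> J = J \<circ> qadjoint T"
    and "\<iota> \<in> imag_units"
    and "E = H_plus J \<iota> \<or> E = H_minus J \<iota>"
  shows "T ` Carrier E \<subseteq> Carrier E \<and> qadjoint T ` Carrier E \<subseteq> Carrier E \<and>
         restrict T (Carrier E) \<in> coperators E \<and> restrict (qadjoint T) (Carrier E) \<in> coperators E \<and>
         cadjoint E (restrict T (Carrier E)) = restrict (qadjoint T) (Carrier E) \<and>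
         (to_slice \<iota> ` cspectrum E (restrict T (Carrier E))
           \<union> qcnj ` to_slice \<iota> ` cspectrum E (restrict T (Carrier E))
         = spherical_spectrum T \<inter> slice \<iota>) \<and>
         spherical_spectrum T = circularization (cspectrum E (restrict T (Carrier E)))"
proof -
  interpret J: qcomplex_structure J \<iota>
    using assms by (intro qcomplex_structureI)
  have adj: "qadjoint T \<in> qoperators"
    using assms(1) by (rule qadjoint_in_qoperators)
  have TJ: "T (J u) = J (T u)" "qadjoint T (J u) = J (qadjoint T u)" for u
    using assms(6,7) by (metis comp_apply)+
  \<comment> \<open>\<open>I\<close> is \<open>J\<close> or its negative, chosen so that
    \<open>E\<close> has the plus form in both cases.\<close>
  obtain I where I: "qcomplex_structure I \<iota>" "E = H_plus I \<iota>"
    and comm: "\<And>u. T (I u) = I (T u)" "\<And>u. qadjoint T (I u) = I (qadjoint T u)"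
  proof (cases "E = H_plus J \<iota>")
    case True
    then show thesis
      using that J.qcomplex_structure_axioms TJ by blast
  next
    case False
    interpret T: bounded_linear T
      using assms(1) by (rule qoperators_bounded_linear)
    interpret A: bounded_linear "qadjoint T"
      using adj by (rule qoperators_bounded_linear)
    have "qcomplex_structure (\<lambda>u. - J u) \<iota>"
    proof
      show "(\<lambda>u. - J u) \<in> qoperators"
        using assms(3) by (simp add: qoperators_def bounded_linear_minus qscale_uminus_left)
    qed (simp_all add: J.J_J J.J_skew J.J.neg qinner_uminus_left qinner_uminus_right assms)
    moreover have "E = H_plus (\<lambda>u. - J u) \<iota>"
      using False assms(9) by (simp add: H_minus_eq_H_plus)
    ultimately show thesis
      by (rule that) (simp_all add: TJ T.neg A.neg)
  qed
  interpret I: qcomplex_structure I \<iota>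
    by fact
  show ?thesis
    unfolding I(2)
    using I.Carrier_E_invariant [OF assms(1) comm(1)] I.Carrier_E_invariant [OF adj comm(2)]
      I.restrict_qoperator_in_coperators [OF assms(1) comm(1)]
      I.restrict_qoperator_in_coperators [OF adj comm(2)]
      I.cadjoint_restrict [OF assms(1) comm]
      I.slice_spectrum [OF assms(1) comm(1)]
      I.spherical_spectrum_eq_circularization [OF assms(1) comm(1)]
    by (intro conjI image_subsetI)
qed

end
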